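(* Let $\mathcal{M}_1,\mathcal{M}_2\subset\{1,\ldots,M\}$ be nonempty and let $0\le u\le t\le \min_{m\in\mathcal{M}_1\cup\mathcal{M}_2}T_m$. For $h\in\{+,-\}$ and $m\in\{1,\ldots,M\}$ put $$J^h_m=\int_u^t\int_{\mathbb{R}_+}\int_K \mathbf{1}_{x\le \mu_c e^{-\kappa(T_m-s)}}\,\pi^h(ds,dx,dy).$$ Then for each $h\in\{+,-\}$ the probability $$\mathbb{P}\left(J_m^h\ge 1\ \text{for every } m\in\mathcal{M}_1\ \text{ and }\ J_m^h=0\ \text{for every } m\in\mathcal{M}_2\right)$$ is equal to $$\left(1-\exp\left(-\int_{u}^t \mu_c \left(e^{-\kappa(T_{\max \mathcal{M}_1}-s)} - e^{-\kappa(T_{\min \mathcal{M}_2}-s)}\right)ds\right)\right) \exp\left(-\int_{u}^t \mu_c e^{-\kappa(T_{\min \mathcal{M}_2}-s)}ds\right)$$ if $\max\mathcal{M}_1<\min\mathcal{M}_2$, and is equal to $0$ otherwise.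
   Context: Let $M\ge1$ be an integer, $0<T_1<T_2<\cdots<T_M$ (maturities), and $\mu_c,\kappa\ge0$. Let $K\subset\mathbb{R}_+$ with $\sigma$-algebra $\mathcal{K}$, and let $\nu$ be a probability measure on $(K,\mathcal{K})$ with $\nu(\{0\})=0$ and $\int_K y^2\nu(dy)<\infty$. On a probability space $(\Omega,\mathcal{F},\mathbb{P})$, $\pi^+$ and $\pi^-$ are independent Poisson random measures on $\mathbb{R}_+\times\mathbb{R}_+\times K$ with the same intensity measure $ds\otimes dx\otimes\nu(dy)$. *)

theory Defs
  imports "HOL-Probability.Probability"
begin

text \<open>
  The \<open>\<sigma>\<close>-algebra on the sample space generated by the evaluations \<open>\<omega> \<mapsto> N \<omega> A\<close>, \<open>A\<close> ranging over
  the measurable sets of \<open>E\<close>.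
\<close>

definition evaluation_sigma :: "'w measure \<Rightarrow> 'e measure \<Rightarrow> ('w \<Rightarrow> 'e measure) \<Rightarrow> 'w set set" where
  "evaluation_sigma P E N = sigma_sets (space P)
     {(\<lambda>\<omega>. emeasure (N \<omega>) A) -` B \<inter> space P | A B. A \<in> sets E \<and> B \<in> sets borel}"

text \<open>
  The measure \<open>E\<close> is the intensity. The mass function is written out because
  \<^const>\<open>poisson_pmf\<close> is not meaningful for rate \<open>0\<close>; here \<open>0 ^ 0 = 1\<close> gives the point mass at \<open>0\<close>.
\<close>

definition poisson_random_measure :: "'w measure \<Rightarrow> 'e measure \<Rightarrow> ('w \<Rightarrow> 'e measure) \<Rightarrow> bool" where
  "poisson_random_measure P E N \<longleftrightarrow>
     (\<forall>\<omega>\<in>space P. sets (N \<omega>) = sets E) \<and>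
     (\<forall>A\<in>sets E. (\<lambda>\<omega>. emeasure (N \<omega>) A) \<in> borel_measurable P) \<and>
     (\<forall>A\<in>sets E. emeasure E A < \<infinity> \<longrightarrow>
        (\<forall>k::nat. \<P>(\<omega> in P. emeasure (N \<omega>) A = of_nat k)
           = measure E A ^ k / fact k * exp (- measure E A))) \<and>
     (\<forall>A\<in>sets E. emeasure E A = \<infinity> \<longrightarrow> (AE \<omega> in P. emeasure (N \<omega>) A = \<infinity>)) \<and>
     (\<forall>(n::nat) A. (\<forall>i<n. A i \<in> sets E) \<and> disjoint_family_on A {..<n} \<longrightarrow>
        prob_space.indep_vars P (\<lambda>_. borel) (\<lambda>i \<omega>. emeasure (N \<omega>) (A i)) {..<n})"

datatype jump_sign = Plus | Minus

definition intensity :: "real measure \<Rightarrow> (real \<times> real \<times> real) measure" where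
  "intensity \<nu> = restrict_space lborel {0..} \<Otimes>\<^sub>M (restrict_space lborel {0..} \<Otimes>\<^sub>M \<nu>)"

text \<open>
  The time integral from \<open>u\<close> to \<open>t\<close> runs over \<open>(u, t]\<close>. The ranges \<open>x \<ge> 0\<close> and \<open>y \<in> K\<close> are
  those of the space of the random measure, \<open>[0, \<infinity>) \<times> [0, \<infinity>) \<times> K\<close>.
\<close>

definition jump_count ::
  "real \<Rightarrow> real \<Rightarrow> real \<Rightarrow> real \<Rightarrow> real \<Rightarrow> (real \<times> real \<times> real) measure \<Rightarrow> ennreal" where
  "jump_count \<mu> \<kappa> u t \<tau> N =
     (\<integral>\<^sup>+ (s, x, y). indicator {u<..t} s * indicator {..\<mu> * exp (- \<kappa> * (\<tau> - s))} x \<partial>N)"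

end

theory Submission imports Defs begin

text \<open>
  The region of points counted by \<open>J\<^sub>m\<close> shrinks as \<open>T\<^sub>m\<close> grows. Hence all counts over \<open>M1\<close> are
  positive iff the one at \<open>Max M1\<close> is, and all counts over \<open>M2\<close> vanish iff the one at \<open>Min M2\<close>
  does. If \<open>Max M1 < Min M2\<close>, the event says that the smaller region is empty and its complement
  in the larger one is not, and these are independent; otherwise the regions are nested the wrong
  way and the event is impossible.
\<close>

text \<open>The set whose indicator is the integrand of \<open>jump_count\<close>. Cutting it out of
  the space of the intensity builds in the ranges of time, mark height and \<open>y\<close>.\<close>

definition jump_region ::
  "real measure \<Rightarrow> real \<Rightarrow> real \<Rightarrow> real \<Rightarrow> real \<Rightarrow> real \<Rightarrow> (real \<times> real \<times> real) set" where
  "jump_region \<nu> \<mu> \<kappa> u t \<tau> =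
     {p \<in> space (intensity \<nu>). fst p \<in> {u<..t} \<and> fst (snd p) \<le> \<mu> * exp (- \<kappa> * (\<tau> - fst p))}"

text \<open>The first two factors carry the trace of the Borel sets on the half-line, so each
  projection is composed with the inclusion of the half-line into the reals.\<close>

lemma measurable_intensity_coordinates:
  shows "fst \<in> borel_measurable (intensity \<nu>)"
    and "(\<lambda>p. fst (snd p)) \<in> borel_measurable (intensity \<nu>)"
proof -
  have id: "(\<lambda>x. x) \<in> borel_measurable (restrict_space lborel {0::real..})"
    by (rule measurable_restrict_space1) simp
  show "fst \<in> borel_measurable (intensity \<nu>)"
    unfolding intensity_def by (rule measurable_compose[OF measurable_fst id])
  show "(\<lambda>p. fst (snd p)) \<in> borel_measurable (intensity \<nu>)"
    unfolding intensity_def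
    by (rule measurable_compose[OF measurable_compose[OF measurable_snd measurable_fst] id])
qed

lemma jump_region_sets: "jump_region \<nu> \<mu> \<kappa> u t \<tau> \<in> sets (intensity \<nu>)"
proof -
  note [measurable] = measurable_intensity_coordinates
  show ?thesis unfolding jump_region_def by measurable
qed

text \<open>At every time \<open>s\<close> the barrier on \<open>x\<close> is nonincreasing in the
  maturity, by the signs of \<open>\<mu>\<close> and \<open>\<kappa>\<close>.\<close>

lemma jump_region_antimono:
  assumes "0 \<le> \<mu>" "0 \<le> \<kappa>" "\<tau> \<le> \<tau>'"
  shows "jump_region \<nu> \<mu> \<kappa> u t \<tau>' \<subseteq> jump_region \<nu> \<mu> \<kappa> u t \<tau>"
proof -
  have "\<mu> * exp (- \<kappa> * (\<tau>' - s)) \<le> \<mu> * exp (- \<kappa> * (\<tau> - s))" for s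
    using assms by (intro mult_left_mono) (auto intro!: mult_left_mono)
  then show ?thesis unfolding jump_region_def by (auto intro: order_trans)
qed

text \<open>Equal sets force equal spaces, and on that space the product of the two indicators is
  the indicator of the region.\<close>

lemma jump_count_eq_emeasure:
  assumes "sets N = sets (intensity \<nu>)"
  shows "jump_count \<mu> \<kappa> u t \<tau> N = emeasure N (jump_region \<nu> \<mu> \<kappa> u t \<tau>)"
proof -
  have "jump_count \<mu> \<kappa> u t \<tau> N = (\<integral>\<^sup>+ p. indicator (jump_region \<nu> \<mu> \<kappa> u t \<tau>) p \<partial>N)"
    unfolding jump_count_def using sets_eq_imp_space_eq[OF assms]
    by (intro nn_integral_cong) (auto simp: jump_region_def split: split_indicator)
  then show ?thesis using jump_region_sets assms by simp
qed

lemma set_integrable_jump_rate: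
  "set_integrable lborel {u..t} (\<lambda>s. \<mu> * exp (- \<kappa> * (\<tau> - s)) :: real)"
  by (intro borel_integrable_atLeastAtMost' continuous_intros)

text \<open>Tonelli: the region is sliced at fixed time, and the masses of the slices are integrated
  over time.\<close>

lemma emeasure_jump_region:
  assumes "prob_space \<nu>" "0 \<le> \<mu>" "0 \<le> u"
  shows "emeasure (intensity \<nu>) (jump_region \<nu> \<mu> \<kappa> u t \<tau>)
    = ennreal (LBINT s:{u..t}. \<mu> * exp (- \<kappa> * (\<tau> - s)))"
proof -
  define R :: "real measure" where "R = restrict_space lborel {0..}"
  define g where "g s = \<mu> * exp (- \<kappa> * (\<tau> - s))" for s
  define G where "G = jump_region \<nu> \<mu> \<kappa> u t \<tau>"
  have g_nonneg: "0 \<le> g s" for s using assms by (simp add: g_def)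
  interpret \<nu>: prob_space \<nu> by fact
  interpret R: sigma_finite_measure R
    unfolding R_def by (intro sigma_finite_measure_restrict_space sigma_finite_lborel) simp
  interpret R\<nu>: pair_sigma_finite R \<nu> ..
  have I: "intensity \<nu> = R \<Otimes>\<^sub>M (R \<Otimes>\<^sub>M \<nu>)" by (simp add: intensity_def R_def)
  have R_interval: "emeasure R {0..b} = ennreal b" "{0..b} \<in> sets R" if "0 \<le> b" for b
    using that by (auto simp: R_def emeasure_restrict_space sets_restrict_space_iff)
  \<comment> \<open>For \<open>s\<close> in \<open>(u, t]\<close> the slice is a rectangle of height
    \<open>g s\<close> over the whole mark space, which has mass 1; for other times it is
    empty.\<close>
  have "emeasure (R \<Otimes>\<^sub>M \<nu>) (Pair s -` G) = ennreal (g s) * indicator {u<..t} s"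
    if "s \<in> space R" for s
  proof (cases "s \<in> {u<..t}")
    case True
    then have "Pair s -` G = {0..g s} \<times> space \<nu>"
      using that unfolding G_def jump_region_def g_def I
      by (auto simp: space_pair_measure R_def space_restrict_space)
    then show ?thesis using True R_interval[OF g_nonneg]
      by (simp add: \<nu>.emeasure_pair_measure_Times \<nu>.emeasure_space_1)
  next
    case False
    then have "Pair s -` G = {}" by (auto simp: G_def jump_region_def)
    then show ?thesis using False by simp
  qed
  moreover have "G \<in> sets (R \<Otimes>\<^sub>M (R \<Otimes>\<^sub>M \<nu>))"
    using jump_region_sets unfolding G_def I[symmetric] .
  ultimately have "emeasure (intensity \<nu>) G = (\<integral>\<^sup>+ s. ennreal (g s) * indicator {u<..t} s \<partial>R)"
    unfolding I by (subst R\<nu>.emeasure_pair_measure_alt) (auto intro: nn_integral_cong)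
  also have "\<dots> = (\<integral>\<^sup>+ s. ennreal (g s) * indicator {u<..t} s * indicator {0..} s \<partial>lborel)"
    unfolding R_def by (rule nn_integral_restrict_space) simp
  \<comment> \<open>Since \<open>0 \<le> u\<close>, the half-line contains the time interval; adding
    the endpoint \<open>u\<close> changes only a null set.\<close>
  also have "\<dots> = (\<integral>\<^sup>+ s. ennreal (indicator {u..t} s *\<^sub>R g s) \<partial>lborel)"
    using AE_lborel_singleton[of u] \<open>0 \<le> u\<close>
    by (intro nn_integral_cong_AE) (auto split: split_indicator)
  also have "\<dots> = ennreal (LBINT s:{u..t}. g s)"
    using set_integrable_jump_rate g_nonneg
    unfolding set_lebesgue_integral_def set_integrable_def g_def
    by (intro nn_integral_eq_integral) auto
  finally show ?thesis unfolding G_def g_def .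
qed

lemma poisson_random_measureD:
  assumes "poisson_random_measure P E N"
  shows "\<And>\<omega>. \<omega> \<in> space P \<Longrightarrow> sets (N \<omega>) = sets E"
    and "\<And>A. A \<in> sets E \<Longrightarrow> (\<lambda>\<omega>. emeasure (N \<omega>) A) \<in> borel_measurable P"
    and "\<And>A k. A \<in> sets E \<Longrightarrow> emeasure E A < \<infinity> \<Longrightarrow>
      \<P>(\<omega> in P. emeasure (N \<omega>) A = of_nat k) = measure E A ^ k / fact k * exp (- measure E A)"
    and "\<And>(n::nat) A. (\<And>i. i < n \<Longrightarrow> A i \<in> sets E) \<Longrightarrow> disjoint_family_on A {..<n} \<Longrightarrow>
      prob_space.indep_vars P (\<lambda>_. borel) (\<lambda>i \<omega>. emeasure (N \<omega>) (A i)) {..<n}"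
  using assms unfolding poisson_random_measure_def by auto

lemma poisson_random_measure_prob_eq_0:
  assumes "poisson_random_measure P E N" "A \<in> sets E" "emeasure E A < \<infinity>"
  shows "\<P>(\<omega> in P. emeasure (N \<omega>) A = 0) = exp (- measure E A)"
  using poisson_random_measureD(3)[OF assms, of 0] by simp

text \<open>
  The counts are not assumed to be integers; that they almost surely are follows because the
  Poisson masses sum to 1.
\<close>

lemma poisson_random_measure_prob_ge_1:
  assumes "prob_space P" and N: "poisson_random_measure P E N"
    and A: "A \<in> sets E" "emeasure E A < \<infinity>"
  shows "\<P>(\<omega> in P. 1 \<le> emeasure (N \<omega>) A) = 1 - exp (- measure E A)"
proof -
  interpret prob_space P by fact
  note [measurable] = poisson_random_measureD(2)[OF N A(1)]
  define F where "F k = {\<omega> \<in> space P. emeasure (N \<omega>) A = of_nat k}" for k :: nat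
  define Z where "Z = {\<omega> \<in> space P. emeasure (N \<omega>) A = 0}"
  define Q where "Q = {\<omega> \<in> space P. 1 \<le> emeasure (N \<omega>) A}"
  have [measurable]: "F k \<in> events" for k unfolding F_def by measurable
  have [measurable]: "Z \<in> events" "Q \<in> events" unfolding Z_def Q_def by measurable
  have "disjoint_family F" unfolding disjoint_family_on_def F_def by auto
  then have "(\<lambda>k. prob (F k)) sums prob (\<Union>k. F k)"
    by (intro finite_measure_UNION) auto
  moreover have "(\<lambda>k. prob (F k)) sums (exp (measure E A) * exp (- measure E A))"
    using sums_mult2[OF exp_converges[of "measure E A"], of "exp (- measure E A)"]
      poisson_random_measureD(3)[OF N A]
    by (simp add: F_def divide_inverse mult.commute)
  ultimately have "prob (\<Union>k. F k) = exp (measure E A) * exp (- measure E A)"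
    by (rule sums_unique2)
  then have "prob (\<Union>k. F k) = 1"
    by (simp flip: exp_add)
  \<comment> \<open>A natural number is 0 or at least 1, so \<open>Z \<union> Q\<close> inherits
    full probability from the events \<open>F k\<close>. As \<open>Z\<close> and \<open>Q\<close>
    are disjoint, \<open>prob Q\<close> is then 1 minus the Poisson mass at 0.\<close>
  moreover have "(\<Union>k. F k) \<subseteq> Z \<union> Q"
  proof
    fix \<omega> assume "\<omega> \<in> (\<Union>k. F k)"
    then obtain k where "\<omega> \<in> F k" by auto
    then show "\<omega> \<in> Z \<union> Q" by (cases k) (auto simp: F_def Z_def Q_def)
  qed
  ultimately have "1 \<le> prob (Z \<union> Q)" using finite_measure_mono[of "\<Union>k. F k" "Z \<union> Q"] by simp
  moreover have "prob (Z \<union> Q) = prob Z + prob Q"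
    by (intro finite_measure_Union) (auto simp: Z_def Q_def)
  ultimately show ?thesis
    using poisson_random_measure_prob_eq_0[OF N A] prob_le_1[of "Z \<union> Q"]
    by (simp add: Z_def Q_def)
qed

text \<open>Counts over disjoint sets are independent, so the probability is the product of those
  for \<open>A\<close> and \<open>B\<close> alone.\<close>

lemma poisson_random_measure_prob_nonempty_empty:
  assumes "prob_space P" and N: "poisson_random_measure P E N"
    and A: "A \<in> sets E" "emeasure E A < \<infinity>" and B: "B \<in> sets E" "emeasure E B < \<infinity>"
    and "A \<inter> B = {}"
  shows "\<P>(\<omega> in P. 1 \<le> emeasure (N \<omega>) A \<and> emeasure (N \<omega>) B = 0)
    = (1 - exp (- measure E A)) * exp (- measure E B)"
proof -
  interpret prob_space P by fact
  \<comment> \<open>Independence is available for finite sequences of sets, so the pair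
    \<open>A\<close>, \<open>B\<close> is written as a sequence of length 2, with \<open>S\<close>
    listing the values allowed for each count.\<close>
  define C where "C i = (if i = 0 then A else B)" for i :: nat
  define S :: "nat \<Rightarrow> ennreal set" where "S i = (if i = 0 then {1..} else {0})" for i
  have two: "{..<2::nat} = {0, 1}" by auto
  have "indep_vars (\<lambda>_. borel) (\<lambda>i \<omega>. emeasure (N \<omega>) (C i)) {..<2}"
    using A B \<open>A \<inter> B = {}\<close>
    by (intro poisson_random_measureD(4)[OF N]) (auto simp: C_def disjoint_family_on_def)
  then have "prob (\<Inter>i\<in>{..<2}. (\<lambda>\<omega>. emeasure (N \<omega>) (C i)) -` S i \<inter> space P)
      = (\<Prod>i\<in>{..<2}. prob ((\<lambda>\<omega>. emeasure (N \<omega>) (C i)) -` S i \<inter> space P))"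
    by (rule indep_varsD) (auto simp: S_def two)
  moreover have "(\<Inter>i\<in>{..<2}. (\<lambda>\<omega>. emeasure (N \<omega>) (C i)) -` S i \<inter> space P)
      = {\<omega> \<in> space P. 1 \<le> emeasure (N \<omega>) A \<and> emeasure (N \<omega>) B = 0}"
    by (auto simp: two C_def S_def)
  moreover have "(\<lambda>\<omega>. emeasure (N \<omega>) (C 0)) -` S 0 \<inter> space P = {\<omega> \<in> space P. 1 \<le> emeasure (N \<omega>) A}"
    "(\<lambda>\<omega>. emeasure (N \<omega>) (C 1)) -` S 1 \<inter> space P = {\<omega> \<in> space P. emeasure (N \<omega>) B = 0}"
    by (auto simp: C_def S_def)
  ultimately show ?thesis
    using poisson_random_measure_prob_ge_1[OF \<open>prob_space P\<close> N A]
      poisson_random_measure_prob_eq_0[OF N B]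
    by (simp add: two)
qed

theorem proposition2:
  fixes M :: nat and T :: "nat \<Rightarrow> real" and \<mu>\<^sub>c \<kappa> u t :: real
    and K :: "real set" and \<K> :: "real set set" and \<nu> :: "real measure"
    and P :: "'w measure" and \<pi> :: "jump_sign \<Rightarrow> 'w \<Rightarrow> (real \<times> real \<times> real) measure"
    and M1 M2 :: "nat set" and h :: jump_sign
  assumes "M \<ge> 1" and "0 < T 1" and "strict_mono_on {1..M} T"
    and "\<mu>\<^sub>c \<ge> 0" and "\<kappa> \<ge> 0"
    and "K \<subseteq> {0..}" and "sigma_algebra K \<K>"
    and "prob_space \<nu>" and "space \<nu> = K" and "sets \<nu> = \<K>"
    and "emeasure \<nu> ({0} \<inter> K) = 0" and "integrable \<nu> (\<lambda>y. y\<^sup>2)"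
    and "prob_space P"
    and "\<And>h. poisson_random_measure P (intensity \<nu>) (\<pi> h)"
    and "prob_space.indep_set P (evaluation_sigma P (intensity \<nu>) (\<pi> Plus))
           (evaluation_sigma P (intensity \<nu>) (\<pi> Minus))"
    and "M1 \<subseteq> {1..M}" and "M1 \<noteq> {}" and "M2 \<subseteq> {1..M}" and "M2 \<noteq> {}"
    and "0 \<le> u" and "u \<le> t" and "t \<le> Min (T ` (M1 \<union> M2))"
  shows "\<P>(\<omega> in P. (\<forall>m\<in>M1. jump_count \<mu>\<^sub>c \<kappa> u t (T m) (\<pi> h \<omega>) \<ge> 1) \<and>
                   (\<forall>m\<in>M2. jump_count \<mu>\<^sub>c \<kappa> u t (T m) (\<pi> h \<omega>) = 0))
    = (if Max M1 < Min M2
       then (1 - exp (- (LBINT s:{u..t}. \<mu>\<^sub>c * (exp (- \<kappa> * (T (Max M1) - s))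
                                               - exp (- \<kappa> * (T (Min M2) - s))))))
            * exp (- (LBINT s:{u..t}. \<mu>\<^sub>c * exp (- \<kappa> * (T (Min M2) - s))))
       else 0)"
proof -
  define \<tau>\<^sub>1 where "\<tau>\<^sub>1 = T (Max M1)"
  define \<tau>\<^sub>2 where "\<tau>\<^sub>2 = T (Min M2)"
  define G where "G \<tau> = jump_region \<nu> \<mu>\<^sub>c \<kappa> u t \<tau>" for \<tau>
  define L where "L \<tau> = (LBINT s:{u..t}. \<mu>\<^sub>c * exp (- \<kappa> * (\<tau> - s)))" for \<tau>
  interpret prob_space P by fact
  note N = \<open>poisson_random_measure P (intensity \<nu>) (\<pi> h)\<close>
  note sets_N = poisson_random_measureD(1)[OF N]
  have fin: "finite M1" "finite M2"
    using assms finite_subset[OF _ finite_atLeastAtMost] by blast+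
  have ends: "Max M1 \<in> M1" "Min M2 \<in> M2" using fin assms by auto
  have T_mono: "T m \<le> T n" if "m \<in> {1..M}" "n \<in> {1..M}" "m \<le> n" for m n
    using strict_mono_onD[OF \<open>strict_mono_on {1..M} T\<close> that(1,2)] that(3)
    by (cases "m = n") auto
  have G_sets: "G \<tau> \<in> sets (intensity \<nu>)" for \<tau>
    unfolding G_def by (rule jump_region_sets)
  have G_antimono: "G \<tau>' \<subseteq> G \<tau>" if "\<tau> \<le> \<tau>'" for \<tau> \<tau>'
    unfolding G_def using assms that by (intro jump_region_antimono)
  have count_antimono: "emeasure (\<pi> h \<omega>) (G \<tau>') \<le> emeasure (\<pi> h \<omega>) (G \<tau>)"
    if "\<tau> \<le> \<tau>'" "\<omega> \<in> space P" for \<tau> \<tau>' \<omega>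
    using G_antimono[OF that(1)] G_sets sets_N[OF that(2)] by (intro emeasure_mono) auto
  have event: "(\<forall>m\<in>M1. jump_count \<mu>\<^sub>c \<kappa> u t (T m) (\<pi> h \<omega>) \<ge> 1) \<and>
      (\<forall>m\<in>M2. jump_count \<mu>\<^sub>c \<kappa> u t (T m) (\<pi> h \<omega>) = 0) \<longleftrightarrow>
      1 \<le> emeasure (\<pi> h \<omega>) (G \<tau>\<^sub>1) \<and> emeasure (\<pi> h \<omega>) (G \<tau>\<^sub>2) = 0"
    if \<omega>: "\<omega> \<in> space P" for \<omega>
  proof -
    \<comment> \<open>\<open>Max M1\<close> indexes the latest maturity in \<open>M1\<close>, hence
      the smallest count there; dually, \<open>Min M2\<close> gives the largest count over
      \<open>M2\<close>.\<close>
    have le1: "emeasure (\<pi> h \<omega>) (G \<tau>\<^sub>1) \<le> emeasure (\<pi> h \<omega>) (G (T m))" if "m \<in> M1" for m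
      unfolding \<tau>\<^sub>1_def using that fin ends \<open>M1 \<subseteq> {1..M}\<close>
      by (intro count_antimono T_mono \<omega>) auto
    have le2: "emeasure (\<pi> h \<omega>) (G (T m)) \<le> emeasure (\<pi> h \<omega>) (G \<tau>\<^sub>2)" if "m \<in> M2" for m
      unfolding \<tau>\<^sub>2_def using that fin ends \<open>M2 \<subseteq> {1..M}\<close>
      by (intro count_antimono T_mono \<omega>) auto
    have "(\<forall>m\<in>M1. 1 \<le> emeasure (\<pi> h \<omega>) (G (T m))) \<longleftrightarrow> 1 \<le> emeasure (\<pi> h \<omega>) (G \<tau>\<^sub>1)"
      using le1 ends(1) unfolding \<tau>\<^sub>1_def by (meson order_trans)
    moreover have "(\<forall>m\<in>M2. emeasure (\<pi> h \<omega>) (G (T m)) = 0) \<longleftrightarrow> emeasure (\<pi> h \<omega>) (G \<tau>\<^sub>2) = 0"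
      using le2 ends(2) unfolding \<tau>\<^sub>2_def by (metis le_zero_eq)
    ultimately show ?thesis
      unfolding jump_count_eq_emeasure[OF sets_N[OF \<omega>]] G_def[symmetric] by (rule arg_cong2)
  qed
  have "\<P>(\<omega> in P. 1 \<le> emeasure (\<pi> h \<omega>) (G \<tau>\<^sub>1) \<and> emeasure (\<pi> h \<omega>) (G \<tau>\<^sub>2) = 0)
    = (if Max M1 < Min M2 then (1 - exp (- (L \<tau>\<^sub>1 - L \<tau>\<^sub>2))) * exp (- L \<tau>\<^sub>2) else 0)"
  proof (cases "Max M1 < Min M2")
    case True
    have "\<tau>\<^sub>1 \<le> \<tau>\<^sub>2"
      unfolding \<tau>\<^sub>1_def \<tau>\<^sub>2_def using True ends assms by (intro T_mono) auto
    note sub = G_antimono[OF this]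
    have G_em: "emeasure (intensity \<nu>) (G \<tau>) = ennreal (L \<tau>)" for \<tau>
      unfolding G_def L_def using assms by (intro emeasure_jump_region) auto
    \<comment> \<open>\<open>ennreal\<close> sends negative reals to 0, so the sign is needed to
      recover \<open>L \<tau>\<close> as the real-valued measure.\<close>
    have "0 \<le> L \<tau>" for \<tau>
      unfolding L_def set_lebesgue_integral_def using \<open>\<mu>\<^sub>c \<ge> 0\<close> by (intro integral_nonneg_AE) auto
    then have G_meas: "measure (intensity \<nu>) (G \<tau>) = L \<tau>" for \<tau>
      by (simp add: measure_def G_em)
    have D_meas: "measure (intensity \<nu>) (G \<tau>\<^sub>1 - G \<tau>\<^sub>2) = L \<tau>\<^sub>1 - L \<tau>\<^sub>2"
      using sub G_sets by (subst measure_Diff) (auto simp: G_em G_meas)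
    have D_fin: "emeasure (intensity \<nu>) (G \<tau>\<^sub>1 - G \<tau>\<^sub>2) < \<infinity>"
      using emeasure_mono[of "G \<tau>\<^sub>1 - G \<tau>\<^sub>2" "G \<tau>\<^sub>1" "intensity \<nu>"] G_sets
      by (auto simp: G_em intro: le_less_trans)
    \<comment> \<open>When \<open>G \<tau>\<^sub>2\<close> is a null set of the realised measure,
      removing it from \<open>G \<tau>\<^sub>1\<close> keeps the count. The event thus becomes one
      about two disjoint sets.\<close>
    have "emeasure (\<pi> h \<omega>) (G \<tau>\<^sub>1) = emeasure (\<pi> h \<omega>) (G \<tau>\<^sub>1 - G \<tau>\<^sub>2)"
      if "emeasure (\<pi> h \<omega>) (G \<tau>\<^sub>2) = 0" "\<omega> \<in> space P" for \<omega>
      using that G_sets sets_N by (subst emeasure_Diff_null_set) auto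
    then have "{\<omega> \<in> space P. 1 \<le> emeasure (\<pi> h \<omega>) (G \<tau>\<^sub>1) \<and> emeasure (\<pi> h \<omega>) (G \<tau>\<^sub>2) = 0}
      = {\<omega> \<in> space P. 1 \<le> emeasure (\<pi> h \<omega>) (G \<tau>\<^sub>1 - G \<tau>\<^sub>2) \<and> emeasure (\<pi> h \<omega>) (G \<tau>\<^sub>2) = 0}"
      by auto
    then show ?thesis
      using poisson_random_measure_prob_nonempty_empty[OF \<open>prob_space P\<close> N _ D_fin, of "G \<tau>\<^sub>2"]
        True G_sets D_meas G_meas
      by (auto simp: G_em)
  next
    case False
    \<comment> \<open>Now \<open>G \<tau>\<^sub>1\<close> lies inside
      \<open>G \<tau>\<^sub>2\<close>, so a zero count on the latter excludes a count of at least 1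
      on the former.\<close>
    have "\<tau>\<^sub>2 \<le> \<tau>\<^sub>1"
      unfolding \<tau>\<^sub>1_def \<tau>\<^sub>2_def using False ends assms by (intro T_mono) auto
    then have "{\<omega> \<in> space P. 1 \<le> emeasure (\<pi> h \<omega>) (G \<tau>\<^sub>1) \<and> emeasure (\<pi> h \<omega>) (G \<tau>\<^sub>2) = 0} = {}"
      using count_antimono by fastforce
    then show ?thesis using False by (simp only: measure_empty if_False)
  qed
  \<comment> \<open>Both exponentials are integrable on the compact interval, so the integral of the
    difference splits.\<close>
  moreover have "(LBINT s:{u..t}. \<mu>\<^sub>c * (exp (- \<kappa> * (\<tau>\<^sub>1 - s)) - exp (- \<kappa> * (\<tau>\<^sub>2 - s)))) = L \<tau>\<^sub>1 - L \<tau>\<^sub>2"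
    unfolding L_def right_diff_distrib[of \<mu>\<^sub>c]
    by (intro set_integral_diff set_integrable_jump_rate)
  \<comment> \<open>\<open>event\<close> holds only for sample points in \<open>space P\<close>; the
    congruence rule supplies that membership when rewriting inside the set.\<close>
  ultimately show ?thesis
    using event unfolding \<tau>\<^sub>1_def[symmetric] \<tau>\<^sub>2_def[symmetric] L_def[symmetric]
    by (simp cong: conj_cong)
qed

end
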